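(* Let $\mathbf{k}$ be a field of characteristic $0$ and $\lambda\in\mathbf{k}$. Let $(V,\rho^L,\rho^R,K_V)$ be a representation over a modified Rota-Baxter Leibniz algebra $(\mathfrak{g},[\cdot,\cdot]_{\mathfrak{g}},K)$ of weight $\lambda$. If two 2-cocycles $(\psi_1,\chi_1)$ and $(\psi_2,\chi_2)$ of $(\mathfrak{g},[\cdot,\cdot]_{\mathfrak{g}},K)$ with coefficients in $(V,\rho^L,\rho^R,K_V)$ are cohomologous, i.e. represent the same class in $H^2_{\mathrm{MLeib}}(\mathfrak{g},V)$, then the abelian extensions $(\mathfrak{g}\oplus V,[\cdot,\cdot]_{\psi_1},K_{\chi_1})$ and $(\mathfrak{g}\oplus V,[\cdot,\cdot]_{\psi_2},K_{\chi_2})$ of $(\mathfrak{g},[\cdot,\cdot]_{\mathfrak{g}},K)$ by $(V,0,K_V)$ are isomorphic.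
   Context: A (left) Leibniz algebra is a vector space with a bilinear bracket satisfying $[x,[y,z]]=[[x,y],z]+[y,[x,z]]$. A modified Rota-Baxter Leibniz algebra of weight $\lambda$ is a Leibniz algebra with a linear map $K$ satisfying $[K(x),K(y)]=K([K(x),y]+[x,K(y)])+\lambda[x,y]$. Morphisms are Leibniz algebra homomorphisms commuting with the operators. A representation of a Leibniz algebra $\mathfrak{g}$ is $(V,\rho^L,\rho^R)$ with $\rho^L,\rho^R:\mathfrak{g}\to\mathfrak{gl}(V)$ linear such that $\rho^L([x,y])=\rho^L(x)\rho^L(y)-\rho^L(y)\rho^L(x)$; $\rho^R([x,y])=\rho^L(x)\rho^R(y)-\rho^R(y)\rho^L(x)$; $\rho^R([x,y])=\rho^L(x)\rho^R(y)+\rho^R(y)\rho^R(x)$. A representation over $(\mathfrak{g},[\cdot,\cdot],K)$ of weight $\lambda$ is such a triple with a linear $K_V:V\to V$ such that for $\rho=\rho^L$ and for $\rho=\rho^R$, $\rho(K(x))K_V(v)=K_V(\rho(K(x))v+\rho(x)K_V(v))+\lambda\rho(x)v$. An abelian extension of $(\mathfrak{g},[\cdot,\cdot]_{\mathfrak{g}},K)$ by $(V,0,K_V)$ (zero bracket on $V$) is a short exact sequence $0\to(V,K_V)\xrightarrow{i}(\hat{\mathfrak{g}},\hat K)\xrightarrow{p}(\mathfrak{g},K)\to0$ of morphisms of modified Rota-Baxter Leibniz algebras. Two abelian extensions $(\hat{\mathfrak{g}}_1,\hat K_1,i_1,p_1)$ and $(\hat{\mathfrak{g}}_2,\hat K_2,i_2,p_2)$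 are isomorphic if there is an isomorphism $\zeta:(\hat{\mathfrak{g}}_1,\hat K_1)\to(\hat{\mathfrak{g}}_2,\hat K_2)$ of modified Rota-Baxter Leibniz algebras with $\zeta\circ i_1=i_2$ and $p_2\circ\zeta=p_1$. For a 2-cocycle $(\psi,\chi)$, the vector space $\mathfrak{g}\oplus V$ with $[x+u,y+v]_\psi=[x,y]_{\mathfrak{g}}+\rho^L(x)v+\rho^R(y)u+\psi(x,y)$ and $K_\chi(x+u)=K(x)+\chi(x)+K_V(u)$ is a modified Rota-Baxter Leibniz algebra of weight $\lambda$, and it is an abelian extension of $\mathfrak{g}$ by $V$ via the inclusion $v\mapsto 0+v$ and the projection $x+v\mapsto x$. Cohomology in the degrees needed. Put $[x,y]_K=[K(x),y]+[x,K(y)]$, $\rho^L_K(x)v=\rho^L(K(x))v-K_V(\rho^L(x)v)$, $\rho^R_K(x)v=\rho^R(K(x))v-K_V(\rho^R(x)v)$. - For $f\in\mathrm{Hom}(\mathfrak{g},V)$: $(\delta^1f)(x,y)=\rho^L(x)f(y)+\rho^R(y)f(x)-f([x,y])$ and $\Phi^1(f)=f\circ K-K_V\circ f$. - For $f\in\mathrm{Hom}(\mathfrak{g}^{\otimes2},V)$: $(\delta^2f)(x,y,z)=\rho^L(x)f(y,z)-\rho^L(y)f(x,z)-\rho^R(z)f(x,y)-f([x,y],z)-f(y,[x,z])+f(x,[y,z])$ and $\Phi^2(f)(x,y)=f(K(x),K(y))-K_V(f(K(x),y)+f(x,K(y)))-\lambda f(x,y)$. - For $v\in V$: $(\partial^0v)(x)=-\rho^R_K(x)v$.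 For $g\in\mathrm{Hom}(\mathfrak{g},V)$: $(\partial^1g)(x,y)=\rho^L_K(x)g(y)+\rho^R_K(y)g(x)-g([x,y]_K)$. Set $C^1_{\mathrm{MLeib}}(\mathfrak{g},V)=\mathrm{Hom}(\mathfrak{g},V)\oplus V$, $C^2_{\mathrm{MLeib}}(\mathfrak{g},V)=\mathrm{Hom}(\mathfrak{g}^{\otimes2},V)\oplus\mathrm{Hom}(\mathfrak{g},V)$, $d^1(f,v)=(\delta^1f,-\partial^0v-\Phi^1f)$, $d^2(f,g)=(\delta^2f,-\partial^1g-\Phi^2f)$. 2-cocycles are elements of $\ker d^2$ and $H^2_{\mathrm{MLeib}}(\mathfrak{g},V)=\ker d^2/\mathrm{im}\,d^1$. *)

theory Defs
  imports
    "HOL-Analysis.Product_Vector"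
    "HOL-Library.Function_Algebras"
    "HOL-Library.Set_Algebras"
begin

text \<open>
  A vector space over a field is a whole type of class \<open>ab_group_add\<close> together with a
  scalar multiplication satisfying the locale \<^locale>\<open>vector_space\<close>; brackets,
  operators, actions and cochains are functions on these types.  Cochains are added and
  subtracted pointwise, and \<open>V\<close> acts through
  \<open>L x = \<rho>\<^sup>L(x)\<close> and \<open>R x = \<rho>\<^sup>R(x)\<close>.
\<close>

definition bilinear_map ::
    "('k::field \<Rightarrow> 'a::ab_group_add \<Rightarrow> 'a) \<Rightarrow> ('k \<Rightarrow> 'b::ab_group_add \<Rightarrow> 'b) \<Rightarrow>
     ('k \<Rightarrow> 'c::ab_group_add \<Rightarrow> 'c) \<Rightarrow> ('a \<Rightarrow> 'b \<Rightarrow> 'c) \<Rightarrow> bool"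
  where "bilinear_map s1 s2 s3 f \<longleftrightarrow>
    (\<forall>x. Vector_Spaces.linear s2 s3 (f x)) \<and> (\<forall>y. Vector_Spaces.linear s1 s3 (\<lambda>x. f x y))"

section \<open>Modified Rota-Baxter Leibniz algebras and their representations\<close>

locale leibniz_algebra = vector_space scaleG
  for scaleG :: "'k::field \<Rightarrow> 'g::ab_group_add \<Rightarrow> 'g" +
  fixes bracket :: "'g \<Rightarrow> 'g \<Rightarrow> 'g"
  assumes bilinear_bracket: "bilinear_map scaleG scaleG scaleG bracket"
    and leibniz: "bracket x (bracket y z) = bracket (bracket x y) z + bracket y (bracket x z)"

locale mrb_leibniz_algebra = leibniz_algebra scaleG bracket
  for scaleG :: "'k::field \<Rightarrow> 'g::ab_group_add \<Rightarrow> 'g" and bracket +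
  fixes K :: "'g \<Rightarrow> 'g" and lam :: 'k
  assumes linear_K: "Vector_Spaces.linear scaleG scaleG K"
    and mrb: "bracket (K x) (K y) =
      K (bracket (K x) y + bracket x (K y)) + scaleG lam (bracket x y)"

text \<open>
  Linearity of \<open>L, R : g \<rightarrow> gl(V)\<close> says that each \<open>L x\<close>, \<open>R x\<close> is an endomorphism of \<open>V\<close>
  depending linearly on \<open>x\<close>, i.e. that \<open>(x, v) \<mapsto> L x v\<close> and \<open>(x, v) \<mapsto> R x v\<close> are bilinear.
\<close>

locale leibniz_representation = leibniz_algebra scaleG bracket + V: vector_space scaleV
  for scaleG :: "'k::field \<Rightarrow> 'g::ab_group_add \<Rightarrow> 'g" and bracket
    and scaleV :: "'k \<Rightarrow> 'v::ab_group_add \<Rightarrow> 'v" +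
  fixes L R :: "'g \<Rightarrow> 'v \<Rightarrow> 'v"
  assumes bilinear_L: "bilinear_map scaleG scaleV scaleV L"
    and bilinear_R: "bilinear_map scaleG scaleV scaleV R"
    and L_bracket: "L (bracket x y) v = L x (L y v) - L y (L x v)"
    and R_bracket: "R (bracket x y) v = L x (R y v) - R y (L x v)"
    and R_bracket': "R (bracket x y) v = L x (R y v) + R y (R x v)"

locale mrb_representation =
  mrb_leibniz_algebra scaleG bracket K lam + leibniz_representation scaleG bracket scaleV L R
  for scaleG :: "'k::field \<Rightarrow> 'g::ab_group_add \<Rightarrow> 'g" and bracket K lam
    and scaleV :: "'k \<Rightarrow> 'v::ab_group_add \<Rightarrow> 'v" and L R +
  fixes KV :: "'v \<Rightarrow> 'v"
  assumes linear_KV: "Vector_Spaces.linear scaleV scaleV KV"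
    and mrb_L: "L (K x) (KV v) = KV (L (K x) v + L x (KV v)) + scaleV lam (L x v)"
    and mrb_R: "R (K x) (KV v) = KV (R (K x) v + R x (KV v)) + scaleV lam (R x v)"

section \<open>Abelian extensions\<close>

locale mrb_leibniz_hom =
  A: mrb_leibniz_algebra scaleA bracketA KA lam + B: mrb_leibniz_algebra scaleB bracketB KB lam
  for scaleA :: "'k::field \<Rightarrow> 'a::ab_group_add \<Rightarrow> 'a" and bracketA KA
    and scaleB :: "'k \<Rightarrow> 'b::ab_group_add \<Rightarrow> 'b" and bracketB KB and lam +
  fixes f :: "'a \<Rightarrow> 'b"
  assumes linear_hom: "Vector_Spaces.linear scaleA scaleB f"
    and hom_bracket: "f (bracketA x y) = bracketB (f x) (f y)"
    and hom_K: "f (KA x) = KB (f x)"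

locale abelian_extension =
  inc: mrb_leibniz_hom scaleV "\<lambda>u v. 0" KV scaleE bracketE KE lam i +
  proj: mrb_leibniz_hom scaleE bracketE KE scaleG bracket K lam p
  for scaleG :: "'k::field \<Rightarrow> 'g::ab_group_add \<Rightarrow> 'g" and bracket K lam
    and scaleV :: "'k \<Rightarrow> 'v::ab_group_add \<Rightarrow> 'v" and KV
    and scaleE :: "'k \<Rightarrow> 'e::ab_group_add \<Rightarrow> 'e" and bracketE KE i p +
  assumes inj_i: "inj i"
    and exact: "range i = {e. p e = 0}"
    and surj_p: "surj p"

text \<open>The two extensions being compared are required to be abelian extensions.\<close>

definition isomorphic_abelian_extensions ::
    "('k::field \<Rightarrow> 'g::ab_group_add \<Rightarrow> 'g) \<Rightarrow> ('g \<Rightarrow> 'g \<Rightarrow> 'g) \<Rightarrow> ('g \<Rightarrow> 'g) \<Rightarrow> 'k \<Rightarrow>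
     ('k \<Rightarrow> 'v::ab_group_add \<Rightarrow> 'v) \<Rightarrow> ('v \<Rightarrow> 'v) \<Rightarrow>
     ('k \<Rightarrow> 'e1::ab_group_add \<Rightarrow> 'e1) \<Rightarrow> ('e1 \<Rightarrow> 'e1 \<Rightarrow> 'e1) \<Rightarrow> ('e1 \<Rightarrow> 'e1) \<Rightarrow>
       ('v \<Rightarrow> 'e1) \<Rightarrow> ('e1 \<Rightarrow> 'g) \<Rightarrow>
     ('k \<Rightarrow> 'e2::ab_group_add \<Rightarrow> 'e2) \<Rightarrow> ('e2 \<Rightarrow> 'e2 \<Rightarrow> 'e2) \<Rightarrow> ('e2 \<Rightarrow> 'e2) \<Rightarrow>
       ('v \<Rightarrow> 'e2) \<Rightarrow> ('e2 \<Rightarrow> 'g) \<Rightarrow> bool"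
  where "isomorphic_abelian_extensions scaleG bracket K lam scaleV KV
      scaleE1 bracketE1 KE1 i1 p1 scaleE2 bracketE2 KE2 i2 p2 \<longleftrightarrow>
    abelian_extension scaleG bracket K lam scaleV KV scaleE1 bracketE1 KE1 i1 p1 \<and>
    abelian_extension scaleG bracket K lam scaleV KV scaleE2 bracketE2 KE2 i2 p2 \<and>
    (\<exists>\<zeta>. mrb_leibniz_hom scaleE1 bracketE1 KE1 scaleE2 bracketE2 KE2 lam \<zeta> \<and> bij \<zeta> \<and>
      \<zeta> \<circ> i1 = i2 \<and> p2 \<circ> \<zeta> = p1)"

text \<open>
  The structure on \<open>g \<oplus> V\<close> attached to \<open>(\<psi>, \<chi>)\<close>, where \<open>x + u\<close> is the pair \<open>(x, u)\<close>.
  The scalar multiplication is \<^const>\<open>module_prod.scale\<close>.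
\<close>

definition ext_bracket ::
    "('g \<Rightarrow> 'g \<Rightarrow> 'g) \<Rightarrow> ('g \<Rightarrow> 'v \<Rightarrow> 'v) \<Rightarrow> ('g \<Rightarrow> 'v \<Rightarrow> 'v) \<Rightarrow> ('g \<Rightarrow> 'g \<Rightarrow> 'v) \<Rightarrow>
     'g \<times> 'v::ab_group_add \<Rightarrow> 'g \<times> 'v \<Rightarrow> 'g \<times> 'v"
  where "ext_bracket bracket L R \<psi> =
    (\<lambda>(x, u) (y, v). (bracket x y, L x v + R y u + \<psi> x y))"

definition ext_operator ::
    "('g \<Rightarrow> 'g) \<Rightarrow> ('v \<Rightarrow> 'v) \<Rightarrow> ('g \<Rightarrow> 'v) \<Rightarrow> 'g \<times> 'v::ab_group_add \<Rightarrow> 'g \<times> 'v"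
  where "ext_operator K KV \<chi> = (\<lambda>(x, u). (K x, \<chi> x + KV u))"

section \<open>Cohomology in low degrees\<close>

definition delta1 :: "('g \<Rightarrow> 'g \<Rightarrow> 'g) \<Rightarrow> ('g \<Rightarrow> 'v \<Rightarrow> 'v) \<Rightarrow> ('g \<Rightarrow> 'v \<Rightarrow> 'v) \<Rightarrow>
    ('g \<Rightarrow> 'v::ab_group_add) \<Rightarrow> 'g \<Rightarrow> 'g \<Rightarrow> 'v"
  where "delta1 bracket L R f = (\<lambda>x y. L x (f y) + R y (f x) - f (bracket x y))"

definition delta2 :: "('g \<Rightarrow> 'g \<Rightarrow> 'g) \<Rightarrow> ('g \<Rightarrow> 'v \<Rightarrow> 'v) \<Rightarrow> ('g \<Rightarrow> 'v \<Rightarrow> 'v) \<Rightarrow>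
    ('g \<Rightarrow> 'g \<Rightarrow> 'v::ab_group_add) \<Rightarrow> 'g \<Rightarrow> 'g \<Rightarrow> 'g \<Rightarrow> 'v"
  where "delta2 bracket L R f = (\<lambda>x y z.
    L x (f y z) - L y (f x z) - R z (f x y)
      - f (bracket x y) z - f y (bracket x z) + f x (bracket y z))"

definition Phi1 :: "('g \<Rightarrow> 'g) \<Rightarrow> ('v \<Rightarrow> 'v) \<Rightarrow> ('g \<Rightarrow> 'v::ab_group_add) \<Rightarrow> 'g \<Rightarrow> 'v"
  where "Phi1 K KV f = (f \<circ> K) - (KV \<circ> f)"

definition Phi2 :: "('g \<Rightarrow> 'g) \<Rightarrow> 'k \<Rightarrow> ('k \<Rightarrow> 'v \<Rightarrow> 'v) \<Rightarrow> ('v \<Rightarrow> 'v) \<Rightarrow>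
    ('g \<Rightarrow> 'g \<Rightarrow> 'v::ab_group_add) \<Rightarrow> 'g \<Rightarrow> 'g \<Rightarrow> 'v"
  where "Phi2 K lam scaleV KV f = (\<lambda>x y.
    f (K x) (K y) - KV (f (K x) y + f x (K y)) - scaleV lam (f x y))"

definition bracketK :: "('g \<Rightarrow> 'g \<Rightarrow> 'g) \<Rightarrow> ('g \<Rightarrow> 'g) \<Rightarrow> 'g \<Rightarrow> 'g \<Rightarrow> 'g::ab_group_add"
  where "bracketK bracket K x y = bracket (K x) y + bracket x (K y)"

text \<open>Applied to \<open>L\<close> and to \<open>R\<close>, this gives \<open>\<rho>\<^sup>L\<^sub>K\<close> and \<open>\<rho>\<^sup>R\<^sub>K\<close>.\<close>

definition actionK :: "('g \<Rightarrow> 'g) \<Rightarrow> ('v \<Rightarrow> 'v) \<Rightarrow> ('g \<Rightarrow> 'v \<Rightarrow> 'v) \<Rightarrow>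
    'g \<Rightarrow> 'v \<Rightarrow> 'v::ab_group_add"
  where "actionK K KV \<rho> x v = \<rho> (K x) v - KV (\<rho> x v)"

definition partial0 :: "('g \<Rightarrow> 'g) \<Rightarrow> ('g \<Rightarrow> 'v \<Rightarrow> 'v) \<Rightarrow> ('v \<Rightarrow> 'v) \<Rightarrow>
    'v::ab_group_add \<Rightarrow> 'g \<Rightarrow> 'v"
  where "partial0 K R KV v = (\<lambda>x. - actionK K KV R x v)"

definition partial1 ::
    "('g \<Rightarrow> 'g \<Rightarrow> 'g) \<Rightarrow> ('g \<Rightarrow> 'g) \<Rightarrow> ('g \<Rightarrow> 'v \<Rightarrow> 'v) \<Rightarrow> ('g \<Rightarrow> 'v \<Rightarrow> 'v) \<Rightarrow> ('v \<Rightarrow> 'v) \<Rightarrow>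
     ('g::ab_group_add \<Rightarrow> 'v::ab_group_add) \<Rightarrow> 'g \<Rightarrow> 'g \<Rightarrow> 'v"
  where "partial1 bracket K L R KV g = (\<lambda>x y.
    actionK K KV L x (g y) + actionK K KV R y (g x) - g (bracketK bracket K x y))"

definition C1_MLeib ::
    "('k::field \<Rightarrow> 'g::ab_group_add \<Rightarrow> 'g) \<Rightarrow> ('k \<Rightarrow> 'v::ab_group_add \<Rightarrow> 'v) \<Rightarrow>
     (('g \<Rightarrow> 'v) \<times> 'v) set"
  where "C1_MLeib scaleG scaleV = {f. Vector_Spaces.linear scaleG scaleV f} \<times> UNIV"

definition C2_MLeib ::
    "('k::field \<Rightarrow> 'g::ab_group_add \<Rightarrow> 'g) \<Rightarrow> ('k \<Rightarrow> 'v::ab_group_add \<Rightarrow> 'v) \<Rightarrow>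
     (('g \<Rightarrow> 'g \<Rightarrow> 'v) \<times> ('g \<Rightarrow> 'v)) set"
  where "C2_MLeib scaleG scaleV =
    {f. bilinear_map scaleG scaleG scaleV f} \<times> {g. Vector_Spaces.linear scaleG scaleV g}"

definition d1_MLeib ::
    "('g \<Rightarrow> 'g \<Rightarrow> 'g) \<Rightarrow> ('g \<Rightarrow> 'g) \<Rightarrow> ('g \<Rightarrow> 'v \<Rightarrow> 'v) \<Rightarrow> ('g \<Rightarrow> 'v \<Rightarrow> 'v) \<Rightarrow> ('v \<Rightarrow> 'v) \<Rightarrow>
     ('g \<Rightarrow> 'v::ab_group_add) \<times> 'v \<Rightarrow> ('g \<Rightarrow> 'g \<Rightarrow> 'v) \<times> ('g \<Rightarrow> 'v)"
  where "d1_MLeib bracket K L R KV = (\<lambda>(f, v).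
    (delta1 bracket L R f, - partial0 K R KV v - Phi1 K KV f))"

definition d2_MLeib ::
    "('g \<Rightarrow> 'g \<Rightarrow> 'g) \<Rightarrow> ('g \<Rightarrow> 'g) \<Rightarrow> 'k \<Rightarrow> ('k \<Rightarrow> 'v \<Rightarrow> 'v) \<Rightarrow>
     ('g \<Rightarrow> 'v \<Rightarrow> 'v) \<Rightarrow> ('g \<Rightarrow> 'v \<Rightarrow> 'v) \<Rightarrow> ('v \<Rightarrow> 'v) \<Rightarrow>
     ('g::ab_group_add \<Rightarrow> 'g \<Rightarrow> 'v::ab_group_add) \<times> ('g \<Rightarrow> 'v) \<Rightarrow>
     ('g \<Rightarrow> 'g \<Rightarrow> 'g \<Rightarrow> 'v) \<times> ('g \<Rightarrow> 'g \<Rightarrow> 'v)"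
  where "d2_MLeib bracket K lam scaleV L R KV = (\<lambda>(f, g).
    (delta2 bracket L R f, - partial1 bracket K L R KV g - Phi2 K lam scaleV KV f))"

definition Z2_MLeib ::
    "('k::field \<Rightarrow> 'g::ab_group_add \<Rightarrow> 'g) \<Rightarrow> ('g \<Rightarrow> 'g \<Rightarrow> 'g) \<Rightarrow> ('g \<Rightarrow> 'g) \<Rightarrow> 'k \<Rightarrow>
     ('k \<Rightarrow> 'v::ab_group_add \<Rightarrow> 'v) \<Rightarrow> ('g \<Rightarrow> 'v \<Rightarrow> 'v) \<Rightarrow> ('g \<Rightarrow> 'v \<Rightarrow> 'v) \<Rightarrow> ('v \<Rightarrow> 'v) \<Rightarrow>
     (('g \<Rightarrow> 'g \<Rightarrow> 'v) \<times> ('g \<Rightarrow> 'v)) set"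
  where "Z2_MLeib scaleG bracket K lam scaleV L R KV =
    {c \<in> C2_MLeib scaleG scaleV. d2_MLeib bracket K lam scaleV L R KV c = 0}"

definition B2_MLeib ::
    "('k::field \<Rightarrow> 'g::ab_group_add \<Rightarrow> 'g) \<Rightarrow> ('g \<Rightarrow> 'g \<Rightarrow> 'g) \<Rightarrow> ('g \<Rightarrow> 'g) \<Rightarrow>
     ('k \<Rightarrow> 'v::ab_group_add \<Rightarrow> 'v) \<Rightarrow> ('g \<Rightarrow> 'v \<Rightarrow> 'v) \<Rightarrow> ('g \<Rightarrow> 'v \<Rightarrow> 'v) \<Rightarrow> ('v \<Rightarrow> 'v) \<Rightarrow>
     (('g \<Rightarrow> 'g \<Rightarrow> 'v) \<times> ('g \<Rightarrow> 'v)) set"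
  where "B2_MLeib scaleG bracket K scaleV L R KV =
    d1_MLeib bracket K L R KV ` C1_MLeib scaleG scaleV"

text \<open>
  The underlying set of the quotient space \<open>ker d\<^sup>2 / im d\<^sup>1\<close>: the class of a cocycle \<open>c\<close> is
  the coset \<open>c + im d\<^sup>1\<close>, written \<open>c +o im d\<^sup>1\<close>.
\<close>

definition H2_MLeib ::
    "('k::field \<Rightarrow> 'g::ab_group_add \<Rightarrow> 'g) \<Rightarrow> ('g \<Rightarrow> 'g \<Rightarrow> 'g) \<Rightarrow> ('g \<Rightarrow> 'g) \<Rightarrow> 'k \<Rightarrow>
     ('k \<Rightarrow> 'v::ab_group_add \<Rightarrow> 'v) \<Rightarrow> ('g \<Rightarrow> 'v \<Rightarrow> 'v) \<Rightarrow> ('g \<Rightarrow> 'v \<Rightarrow> 'v) \<Rightarrow> ('v \<Rightarrow> 'v) \<Rightarrow>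
     (('g \<Rightarrow> 'g \<Rightarrow> 'v) \<times> ('g \<Rightarrow> 'v)) set set"
  where "H2_MLeib scaleG bracket K lam scaleV L R KV =
    (\<lambda>c. c +o B2_MLeib scaleG bracket K scaleV L R KV) `
      Z2_MLeib scaleG bracket K lam scaleV L R KV"

definition cohomologous ::
    "('k::field \<Rightarrow> 'g::ab_group_add \<Rightarrow> 'g) \<Rightarrow> ('g \<Rightarrow> 'g \<Rightarrow> 'g) \<Rightarrow> ('g \<Rightarrow> 'g) \<Rightarrow> 'k \<Rightarrow>
     ('k \<Rightarrow> 'v::ab_group_add \<Rightarrow> 'v) \<Rightarrow> ('g \<Rightarrow> 'v \<Rightarrow> 'v) \<Rightarrow> ('g \<Rightarrow> 'v \<Rightarrow> 'v) \<Rightarrow> ('v \<Rightarrow> 'v) \<Rightarrow>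
     ('g \<Rightarrow> 'g \<Rightarrow> 'v) \<times> ('g \<Rightarrow> 'v) \<Rightarrow> ('g \<Rightarrow> 'g \<Rightarrow> 'v) \<times> ('g \<Rightarrow> 'v) \<Rightarrow> bool"
  where "cohomologous scaleG bracket K lam scaleV L R KV c1 c2 \<longleftrightarrow>
    (\<exists>h \<in> H2_MLeib scaleG bracket K lam scaleV L R KV. c1 \<in> h \<and> c2 \<in> h)"

end

theory Submission
  imports Defs
begin

text \<open>
  Let \<open>(\<psi>\<^sub>1 - \<psi>\<^sub>2, \<chi>\<^sub>1 - \<chi>\<^sub>2) = d\<^sup>1(f, v)\<close>.  A map \<open>x + u \<mapsto> x + u + h(x)\<close> is an isomorphism of the
  two extensions exactly when \<open>\<psi>\<^sub>1 - \<psi>\<^sub>2 = \<delta>\<^sup>1h\<close> and \<open>\<chi>\<^sub>1 - \<chi>\<^sub>2 = -\<Phi>\<^sup>1h\<close>.  The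
  component \<open>v\<close> is absorbed by the 1-cochain \<open>x \<mapsto> \<rho>\<^sup>R(x)v\<close>: by the third representation axiom it
  is killed by \<open>\<delta>\<^sup>1\<close>, and \<open>\<Phi>\<^sup>1\<close> sends it to \<open>-\<partial>\<^sup>0v\<close>.
  Hence \<open>h(x) = f(x) - \<rho>\<^sup>R(x)v\<close> works.
\<close>

lemma linearD:
  assumes "Vector_Spaces.linear s1 s2 f"
  shows "f (x + y) = f x + f y" "f (x - y) = f x - f y" "f (- x) = - f x" "f 0 = 0"
    "f (s1 c x) = s2 c (f x)"
proof -
  interpret Vector_Spaces.linear s1 s2 f by fact
  show "f (x + y) = f x + f y" "f (x - y) = f x - f y" "f (- x) = - f x" "f 0 = 0"
    "f (s1 c x) = s2 c (f x)"
    by (fact add diff neg zero scale)+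
qed

lemma bilinear_mapD:
  assumes "bilinear_map s1 s2 s3 f"
  shows "Vector_Spaces.linear s2 s3 (f x)" "Vector_Spaces.linear s1 s3 (\<lambda>x. f x y)"
  using assms by (auto simp: bilinear_map_def)

lemmas bilinear_map_simps =
  linearD[OF bilinear_mapD(1)] linearD[OF bilinear_mapD(2)]

text \<open>This takes the componentwise formula out of the product locale, which is where both
  vector space hypotheses enter.\<close>

lemma scale_prod_Pair:
  assumes "vector_space s1" "vector_space s2"
  shows "module_prod.scale s1 s2 c (x, u) = (s1 c x, s2 c u)"
proof -
  interpret vector_space_prod s1 s2 by (intro vector_space_prod.intro vector_space_pair.intro assms)
  show ?thesis by (simp add: scale_def)
qed

context mrb_representation
begin

abbreviation "scaleE \<equiv> module_prod.scale scaleG scaleV"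

lemmas rep_vector_spaces = vector_space_axioms V.vector_space_axioms

lemma vector_space_ext: "vector_space scaleE"
proof -
  interpret vector_space_prod scaleG scaleV
    by (intro vector_space_prod.intro vector_space_pair.intro rep_vector_spaces)
  show ?thesis by (fact p.vector_space_axioms)
qed

lemmas scaleE_Pair = scale_prod_Pair[OF rep_vector_spaces]

lemmas rep_simps =
  bilinear_map_simps[OF bilinear_bracket] bilinear_map_simps[OF bilinear_L]
  bilinear_map_simps[OF bilinear_R] linearD[OF linear_K] linearD[OF linear_KV]
  V.scale_right_distrib V.scale_right_diff_distrib scale_right_distrib
  V.scale_left_distrib scale_left_distrib

text \<open>Equate the two expressions for \<open>R (bracket x y) v\<close>. As a rewrite rule it
  removes compositions of two right actions from the Leibniz identity of the extension.\<close>

lemma R_R: "R y (R x v) = - R y (L x v)"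
  using R_bracket[of x y v] R_bracket'[of x y v] by simp

lemma mrb_leibniz_algebra_zero: "mrb_leibniz_algebra scaleV (\<lambda>u v. 0) KV lam"
  by unfold_locales
    (auto simp: bilinear_map_def Vector_Spaces.linear_iff rep_vector_spaces linear_KV rep_simps)

text \<open>In the \<open>V\<close> component, the terms carrying a vector of \<open>V\<close>
  cancel by the representation axioms. What remains of the Leibniz identity is the vanishing of
  \<open>delta2\<close>, and what remains of the operator identity is the vanishing of the second
  component of \<open>d2_MLeib\<close>.\<close>

lemma mrb_leibniz_algebra_ext:
  assumes "(\<psi>, \<chi>) \<in> Z2_MLeib scaleG bracket K lam scaleV L R KV"
  shows "mrb_leibniz_algebra scaleE (ext_bracket bracket L R \<psi>) (ext_operator K KV \<chi>) lam"
proof -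
  have psi: "bilinear_map scaleG scaleG scaleV \<psi>" and chi: "Vector_Spaces.linear scaleG scaleV \<chi>"
    and d2: "d2_MLeib bracket K lam scaleV L R KV (\<psi>, \<chi>) = 0"
    using assms by (auto simp: Z2_MLeib_def C2_MLeib_def)
  note simps = rep_simps bilinear_map_simps[OF psi] linearD[OF chi]
  have delta: "\<psi> x (bracket y z) = \<psi> (bracket x y) z + \<psi> y (bracket x z) + R z (\<psi> x y)
      + L y (\<psi> x z) - L x (\<psi> y z)" for x y z
  proof -
    have "delta2 bracket L R \<psi> x y z = 0"
      using d2 by (simp add: d2_MLeib_def zero_prod_def fun_eq_iff)
    then show ?thesis by (simp add: delta2_def algebra_simps)
  qed
  \<comment> \<open>Like \<open>delta\<close>, the cocycle condition is solved for the term that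
    occurs on the left of the identity to be proved.\<close>
  have Phi: "\<psi> (K x) (K y) = \<chi> (bracketK bracket K x y) - actionK K KV L x (\<chi> y)
      - actionK K KV R y (\<chi> x) + KV (\<psi> (K x) y + \<psi> x (K y)) + scaleV lam (\<psi> x y)" for x y
  proof -
    have "- partial1 bracket K L R KV \<chi> x y - Phi2 K lam scaleV KV \<psi> x y = 0"
      using d2 by (simp add: d2_MLeib_def zero_prod_def fun_eq_iff)
    then show ?thesis by (simp add: partial1_def Phi2_def algebra_simps)
  qed
  show ?thesis
  proof (intro mrb_leibniz_algebra.intro leibniz_algebra.intro)
    show "vector_space scaleE" by (fact vector_space_ext)
    show "leibniz_algebra_axioms scaleE (ext_bracket bracket L R \<psi>)"
    proof
      show "bilinear_map scaleE scaleE scaleE (ext_bracket bracket L R \<psi>)"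
        by (auto simp: bilinear_map_def Vector_Spaces.linear_iff vector_space_ext scaleE_Pair
            ext_bracket_def simps)
      fix X Y Z
      show "ext_bracket bracket L R \<psi> X (ext_bracket bracket L R \<psi> Y Z) =
        ext_bracket bracket L R \<psi> (ext_bracket bracket L R \<psi> X Y) Z +
        ext_bracket bracket L R \<psi> Y (ext_bracket bracket L R \<psi> X Z)"
        \<comment> \<open>\<open>leibniz\<close> and \<open>delta\<close> are instantiated because
          their right-hand sides match their own left-hand sides again and would loop.\<close>
        by (simp add: ext_bracket_def split_beta leibniz[of "fst X" "fst Y" "fst Z"] L_bracket
            R_bracket R_R delta[of "fst X" "fst Y" "fst Z"] simps)
    qed
    show "mrb_leibniz_algebra_axioms scaleE (ext_bracket bracket L R \<psi>) (ext_operator K KV \<chi>) lam"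
    proof (rule mrb_leibniz_algebra_axioms.intro)
      show "Vector_Spaces.linear scaleE scaleE (ext_operator K KV \<chi>)"
        by (auto simp: Vector_Spaces.linear_iff vector_space_ext scaleE_Pair
            ext_operator_def simps)
      fix X Y
      show "ext_bracket bracket L R \<psi> (ext_operator K KV \<chi> X) (ext_operator K KV \<chi> Y) =
        ext_operator K KV \<chi> (ext_bracket bracket L R \<psi> (ext_operator K KV \<chi> X) Y +
          ext_bracket bracket L R \<psi> X (ext_operator K KV \<chi> Y)) +
        scaleE lam (ext_bracket bracket L R \<psi> X Y)"
        by (cases X; cases Y)
          (simp add: ext_bracket_def ext_operator_def scaleE_Pair mrb mrb_L mrb_R Phi simps
            actionK_def bracketK_def)
    qed
  qed
qed

text \<open>\<open>isomorphic_abelian_extensions\<close> demands this of both sides.\<close>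

lemma abelian_extension_ext:
  assumes "(\<psi>, \<chi>) \<in> Z2_MLeib scaleG bracket K lam scaleV L R KV"
  shows "abelian_extension scaleG bracket K lam scaleV KV
    scaleE (ext_bracket bracket L R \<psi>) (ext_operator K KV \<chi>) (\<lambda>v. (0, v)) fst"
proof -
  have psi: "bilinear_map scaleG scaleG scaleV \<psi>" and chi: "Vector_Spaces.linear scaleG scaleV \<chi>"
    using assms by (auto simp: Z2_MLeib_def C2_MLeib_def)
  note simps = rep_simps bilinear_map_simps[OF psi] linearD[OF chi]
  \<comment> \<open>On the image of \<open>V\<close> the bracket vanishes because
    \<open>L 0\<close>, \<open>R 0\<close> and \<open>\<psi> 0 0\<close> do, and
    \<open>\<chi> 0 = 0\<close> reduces the operator to \<open>KV\<close>.\<close>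
  have "mrb_leibniz_hom scaleV (\<lambda>u v. 0) KV
      scaleE (ext_bracket bracket L R \<psi>) (ext_operator K KV \<chi>) lam (\<lambda>v. (0, v))"
    by (intro mrb_leibniz_hom.intro mrb_leibniz_algebra_zero mrb_leibniz_algebra_ext[OF assms],
        unfold_locales)
      (auto simp: Vector_Spaces.linear_iff rep_vector_spaces vector_space_ext scaleE_Pair
        ext_bracket_def ext_operator_def simps zero_prod_def)
  moreover have "mrb_leibniz_hom scaleE (ext_bracket bracket L R \<psi>) (ext_operator K KV \<chi>)
      scaleG bracket K lam fst"
    by (intro mrb_leibniz_hom.intro mrb_leibniz_algebra_axioms mrb_leibniz_algebra_ext[OF assms],
        unfold_locales)
      (auto simp: Vector_Spaces.linear_iff rep_vector_spaces vector_space_ext scaleE_Pair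
        ext_bracket_def ext_operator_def rep_simps)
  moreover have "range (\<lambda>v. (0, v)) = {e. fst e = 0}"
    by (auto simp: image_iff)
  ultimately show ?thesis
    by (intro abelian_extension.intro abelian_extension_axioms.intro) (auto simp: inj_def)
qed

lemma delta1_R: "delta1 bracket L R (\<lambda>x. R x v) = 0"
  by (simp add: delta1_def fun_eq_iff R_bracket')

lemma Phi1_R: "Phi1 K KV (\<lambda>x. R x v) = - partial0 K R KV v"
  by (simp add: Phi1_def partial0_def actionK_def fun_eq_iff)

lemma linear_diff_rep:
  assumes "Vector_Spaces.linear scaleG scaleV f" "Vector_Spaces.linear scaleG scaleV g"
  shows "Vector_Spaces.linear scaleG scaleV (\<lambda>x. f x - g x)"
  using linearD[OF assms(1)] linearD[OF assms(2)]
  by (simp add: Vector_Spaces.linear_iff rep_vector_spaces rep_simps)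

text \<open>Differences occur twice below: between the cochains of two elements of one coset, and
  when the correction \<open>R x v\<close> is split off.\<close>

lemma delta1_diff:
  "delta1 bracket L R (\<lambda>x. f x - g x) = delta1 bracket L R f - delta1 bracket L R g"
  by (simp add: delta1_def fun_eq_iff rep_simps)

lemma Phi1_diff: "Phi1 K KV (\<lambda>x. f x - g x) = Phi1 K KV f - Phi1 K KV g"
  by (simp add: Phi1_def fun_eq_iff rep_simps)

lemma partial0_diff: "partial0 K R KV (u - v) = partial0 K R KV u - partial0 K R KV v"
  by (simp add: partial0_def actionK_def fun_eq_iff rep_simps)

lemma cohomologous_diff:
  assumes "cohomologous scaleG bracket K lam scaleV L R KV (\<psi>1, \<chi>1) (\<psi>2, \<chi>2)"
  obtains h where "Vector_Spaces.linear scaleG scaleV h"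
    "\<psi>1 - \<psi>2 = delta1 bracket L R h" "\<chi>1 - \<chi>2 = - Phi1 K KV h"
proof -
  \<comment> \<open>A common class only provides a representative \<open>c\<close> from which each
    cocycle differs by a coboundary.\<close>
  obtain c f1 v1 f2 v2 where
    f1: "Vector_Spaces.linear scaleG scaleV f1" and f2: "Vector_Spaces.linear scaleG scaleV f2"
    and "(\<psi>1, \<chi>1) = c + d1_MLeib bracket K L R KV (f1, v1)"
      "(\<psi>2, \<chi>2) = c + d1_MLeib bracket K L R KV (f2, v2)"
    using assms
    by (fastforce simp: cohomologous_def H2_MLeib_def B2_MLeib_def C1_MLeib_def elt_set_plus_def)
  then have "(\<psi>1, \<chi>1) - (\<psi>2, \<chi>2) =
      d1_MLeib bracket K L R KV (f1, v1) - d1_MLeib bracket K L R KV (f2, v2)"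
    \<comment> \<open>Without \<open>diff_Pair\<close> the pairs stay intact, so the facts above
      rewrite them and \<open>c\<close> cancels.\<close>
    by (simp del: diff_Pair)
  also have "\<dots> = d1_MLeib bracket K L R KV (\<lambda>x. f1 x - f2 x, v1 - v2)"
    by (simp add: d1_MLeib_def delta1_diff Phi1_diff partial0_diff)
  finally have eq: "\<psi>1 - \<psi>2 = delta1 bracket L R (\<lambda>x. f1 x - f2 x)"
    "\<chi>1 - \<chi>2 = - partial0 K R KV (v1 - v2) - Phi1 K KV (\<lambda>x. f1 x - f2 x)"
    by (simp_all add: d1_MLeib_def)
  show thesis
  proof
    \<comment> \<open>The cochain to be corrected is \<open>(f1 - f2, v1 - v2)\<close>.\<close>
    show "Vector_Spaces.linear scaleG scaleV (\<lambda>x. (f1 x - f2 x) - R x (v1 - v2))"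
      by (intro linear_diff_rep f1 f2 bilinear_mapD(2)[OF bilinear_R])
    show "\<psi>1 - \<psi>2 = delta1 bracket L R (\<lambda>x. (f1 x - f2 x) - R x (v1 - v2))"
      unfolding eq delta1_diff[of "\<lambda>x. f1 x - f2 x"] delta1_R by simp
    show "\<chi>1 - \<chi>2 = - Phi1 K KV (\<lambda>x. (f1 x - f2 x) - R x (v1 - v2))"
      unfolding eq Phi1_diff[of "\<lambda>x. f1 x - f2 x"] Phi1_R by simp
  qed
qed

lemma isomorphic_abelian_extensions_ext:
  assumes c1: "(\<psi>1, \<chi>1) \<in> Z2_MLeib scaleG bracket K lam scaleV L R KV"
    and c2: "(\<psi>2, \<chi>2) \<in> Z2_MLeib scaleG bracket K lam scaleV L R KV"
    and h: "Vector_Spaces.linear scaleG scaleV h"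
    and psi: "\<psi>1 - \<psi>2 = delta1 bracket L R h" and chi: "\<chi>1 - \<chi>2 = - Phi1 K KV h"
  shows "isomorphic_abelian_extensions scaleG bracket K lam scaleV KV
    scaleE (ext_bracket bracket L R \<psi>1) (ext_operator K KV \<chi>1) (\<lambda>v. (0, v)) fst
    scaleE (ext_bracket bracket L R \<psi>2) (ext_operator K KV \<chi>2) (\<lambda>v. (0, v)) fst"
proof -
  define \<zeta> where "\<zeta> = (\<lambda>(x, u). (x, u + h x))"
  \<comment> \<open>This and \<open>chi1\<close> are the compatibility of \<open>\<zeta>\<close>
    with brackets and operators, read off on the elements \<open>(x, 0)\<close>.\<close>
  have psi1: "\<psi>1 x y = \<psi>2 x y + L x (h y) + R y (h x) - h (bracket x y)" for x y
    using fun_cong[OF fun_cong[OF psi, of x], of y] by (simp add: delta1_def algebra_simps)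
  have chi1: "\<chi>1 x = \<chi>2 x - h (K x) + KV (h x)" for x
    using fun_cong[OF chi, of x] by (simp add: Phi1_def algebra_simps)
  have "mrb_leibniz_hom scaleE (ext_bracket bracket L R \<psi>1) (ext_operator K KV \<chi>1)
      scaleE (ext_bracket bracket L R \<psi>2) (ext_operator K KV \<chi>2) lam \<zeta>"
    by (intro mrb_leibniz_hom.intro mrb_leibniz_algebra_ext c1 c2, unfold_locales)
      (auto simp: \<zeta>_def Vector_Spaces.linear_iff vector_space_ext scaleE_Pair ext_bracket_def
        ext_operator_def psi1 chi1 linearD[OF h] rep_simps)
  moreover have "bij \<zeta>"
    by (rule o_bij[of "\<lambda>(x, u). (x, u - h x)"]) (auto simp: \<zeta>_def fun_eq_iff)
  \<comment> \<open>Compatibility with the inclusions amounts to \<open>h 0 = 0\<close>.\<close>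
  moreover have "\<zeta> \<circ> (\<lambda>v. (0, v)) = (\<lambda>v. (0, v))" "fst \<circ> \<zeta> = fst"
    by (auto simp: \<zeta>_def fun_eq_iff linearD[OF h])
  ultimately show ?thesis
    unfolding isomorphic_abelian_extensions_def
    using abelian_extension_ext[OF c1] abelian_extension_ext[OF c2] by blast
qed

end

theorem proposition5p8:
  fixes scaleG :: "'k::field_char_0 \<Rightarrow> 'g::ab_group_add \<Rightarrow> 'g"
    and bracket :: "'g \<Rightarrow> 'g \<Rightarrow> 'g"
    and K :: "'g \<Rightarrow> 'g"
    and lam :: 'k
    and scaleV :: "'k \<Rightarrow> 'v::ab_group_add \<Rightarrow> 'v"
    and L R :: "'g \<Rightarrow> 'v \<Rightarrow> 'v"
    and KV :: "'v \<Rightarrow> 'v"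
    and \<psi>1 \<psi>2 :: "'g \<Rightarrow> 'g \<Rightarrow> 'v"
    and \<chi>1 \<chi>2 :: "'g \<Rightarrow> 'v"
  assumes rep: "mrb_representation scaleG bracket K lam scaleV L R KV"
    and cocycle1: "(\<psi>1, \<chi>1) \<in> Z2_MLeib scaleG bracket K lam scaleV L R KV"
    and cocycle2: "(\<psi>2, \<chi>2) \<in> Z2_MLeib scaleG bracket K lam scaleV L R KV"
    and cohom: "cohomologous scaleG bracket K lam scaleV L R KV (\<psi>1, \<chi>1) (\<psi>2, \<chi>2)"
  shows "isomorphic_abelian_extensions scaleG bracket K lam scaleV KV
    (module_prod.scale scaleG scaleV)
      (ext_bracket bracket L R \<psi>1) (ext_operator K KV \<chi>1) (\<lambda>v. (0, v)) fst
    (module_prod.scale scaleG scaleV)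
      (ext_bracket bracket L R \<psi>2) (ext_operator K KV \<chi>2) (\<lambda>v. (0, v)) fst"
proof -
  interpret mrb_representation scaleG bracket K lam scaleV L R KV by (fact rep)
  from cohom show ?thesis
    by (rule cohomologous_diff) (rule isomorphic_abelian_extensions_ext[OF cocycle1 cocycle2])
qed

end
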